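(* Let an $s$-stage Runge--Kutta method of order at least one be given with coefficients $(A,b)$, $A\in\mathbb{R}^{s\times s}$, $b\in\mathbb{R}^s$, and SSP coefficient $\mathcal{C}(A,b)>0$. Then a first-order dense output with the same SSP coefficient, $\mathcal{C}(A,\overline{b})=\mathcal{C}(A,b)$, is obtained by taking $\overline{b}_j(\theta):=b_j\theta$ for $1\le j\le s$ and $\theta\in[0,1]$; i.e. $u_{n+\theta}=u_n+h\,\theta\sum_{j=1}^s b_jf(y_j)$.
   Context: An $s$-stage Runge--Kutta method $(A,b)$, with $A=(a_{i,j})\in\mathbb{R}^{s\times s}$ and $b\in\mathbb{R}^s$, approximates solutions of $u'=f(u)$ by $y_i=u_n+h\sum_{j=1}^s a_{i,j}f(y_j)$, $u_{n+1}=u_n+h\sum_{j=1}^s b_jf(y_j)$. It has order at least one if $\sum_{j=1}^s b_j=1$. A dense output formula for it is given by a function $\overline{b}=(\overline{b}_1,\dots,\overline{b}_s):[0,1]\to\mathbb{R}^s$, via $u_{n+\theta}=u_n+h\sum_{j=1}^s\overline{b}_j(\theta)f(y_j)$. It is called first-order if it satisfies the first-order condition $\sum_{j=1}^s\overline{b}_j(\theta)=\theta$ for all $\theta\in[0,1]$. Let $e=(1,\dots,1)^\top\in\mathbb{R}^s$; all matrix/vector inequalities are componentwise. For $r\ge 0$ such that $(I+rA)^{-1}$ exists consider the conditions (i) $A(I+rA)^{-1}\ge 0$ and $rA(I+rA)^{-1}e\le 1$; (ii) $b^\top(I+rA)^{-1}\ge 0$ and $rb^\top(I+rA)^{-1}e\le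 1$; (iii) $\overline{b}(\theta)^\top(I+rA)^{-1}\ge 0$ and $r\overline{b}(\theta)^\top(I+rA)^{-1}e\le 1$ for all $0\le\theta\le 1$. $\mathcal{C}(A,b)$ is the supremum of the set of $r\ge 0$ for which $(I+rA)^{-1}$ exists and (i), (ii) hold (and $0$ if this set is empty). $\mathcal{C}(A,\overline{b})$ is the supremum of the set of $r\ge 0$ for which $(I+rA)^{-1}$ exists and (i), (iii) hold (and $0$ if this set is empty). Suprema are taken in $[0,\infty]$. *)

theory Defs
  imports "HOL-Analysis.Analysis"
begin

text \<open>
  A Runge--Kutta method with \<open>s\<close> stages is a pair \<open>(A, b)\<close> with \<open>A :: real^'s^'s\<close> and
  \<open>b :: real^'s\<close>, where \<open>s = CARD('s)\<close>.  The right-hand side \<open>f\<close> of \<open>u' = f(u)\<close> acts on an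
  arbitrary real vector space.
\<close>

definition rk_order_at_least_one :: "real^'s \<Rightarrow> bool" where
  "rk_order_at_least_one b \<longleftrightarrow> (\<Sum>j\<in>UNIV. b $ j) = 1"

definition rk_stages ::
  "real^'s^'s \<Rightarrow> ('v::real_vector \<Rightarrow> 'v) \<Rightarrow> real \<Rightarrow> 'v \<Rightarrow> ('s \<Rightarrow> 'v) \<Rightarrow> bool" where
  "rk_stages A f h u y \<longleftrightarrow> (\<forall>i. y i = u + h *\<^sub>R (\<Sum>j\<in>UNIV. (A $ i $ j) *\<^sub>R f (y j)))"

text \<open>
  A dense output formula is a function on the interval \<open>[0, 1]\<close>; it is represented by a total
  function \<open>bb :: real \<Rightarrow> real^'s\<close> whose values outside \<open>{0..1}\<close> are never used.
\<close>

definition dense_output ::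
  "(real \<Rightarrow> real^'s) \<Rightarrow> ('v::real_vector \<Rightarrow> 'v) \<Rightarrow> real \<Rightarrow> 'v \<Rightarrow> ('s \<Rightarrow> 'v) \<Rightarrow> real \<Rightarrow> 'v" where
  "dense_output bb f h u y \<theta> = u + h *\<^sub>R (\<Sum>j\<in>UNIV. (bb \<theta> $ j) *\<^sub>R f (y j))"

definition first_order_dense :: "(real \<Rightarrow> real^'s) \<Rightarrow> bool" where
  "first_order_dense bb \<longleftrightarrow> (\<forall>\<theta>\<in>{0..1}. (\<Sum>j\<in>UNIV. bb \<theta> $ j) = \<theta>)"

text \<open>
  The order on vectors and matrices is componentwise.  The vector \<open>1 :: real^'s\<close> is the all-ones
  vector \<open>e\<close>, whereas \<open>mat 1\<close> is the identity matrix.  The matrix \<open>resolvent r A\<close> is only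
  meaningful where \<open>mat 1 + r *\<^sub>R A\<close> is invertible, and it is only used under that condition.
\<close>

definition resolvent :: "real \<Rightarrow> real^'s^'s \<Rightarrow> real^'s^'s" where
  "resolvent r A = matrix_inv (mat 1 + r *\<^sub>R A)"

definition stage_condition :: "real^'s^'s \<Rightarrow> real \<Rightarrow> bool" where
  "stage_condition A r \<longleftrightarrow>
     0 \<le> A ** resolvent r A \<and> r *\<^sub>R ((A ** resolvent r A) *v 1) \<le> 1"

definition weight_condition :: "real^'s^'s \<Rightarrow> real^'s \<Rightarrow> real \<Rightarrow> bool" where
  "weight_condition A b r \<longleftrightarrow>
     0 \<le> b v* resolvent r A \<and> r * ((b v* resolvent r A) \<bullet> 1) \<le> 1"

text \<open>Suprema are taken in \<open>ennreal\<close>, where the supremum of the empty set is \<open>0\<close>.\<close>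

definition ssp_coeff :: "real^'s^'s \<Rightarrow> real^'s \<Rightarrow> ennreal" where
  "ssp_coeff A b =
     Sup (ennreal ` {r. r \<ge> 0 \<and> invertible (mat 1 + r *\<^sub>R A) \<and>
                        stage_condition A r \<and> weight_condition A b r})"

definition ssp_coeff_dense :: "real^'s^'s \<Rightarrow> (real \<Rightarrow> real^'s) \<Rightarrow> ennreal" where
  "ssp_coeff_dense A bb =
     Sup (ennreal ` {r. r \<ge> 0 \<and> invertible (mat 1 + r *\<^sub>R A) \<and>
                        stage_condition A r \<and> (\<forall>\<theta>\<in>{0..1}. weight_condition A (bb \<theta>) r)})"

end

theory Submission
  imports Defs
begin

text \<open>For fixed \<open>A\<close> and \<open>r\<close>, the weight condition consists of linear
  inequalities in \<open>b\<close>: some linear forms are \<ge> 0 and one is \<le> 1. Scaling by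
  \<theta> in [0,1] preserves them (\<open>weight_condition_scaleR\<close>), and \<theta> = 1 gives
  back \<open>b\<close> itself. So the dense condition on \<theta> b and the condition on
  \<open>b\<close> admit the same \<open>r\<close> (\<open>all_weight_condition_scaleR_iff\<close>),
  and the suprema agree. First order is the order condition on \<open>b\<close> multiplied by
  \<theta>.\<close>

lemma vector_scaleR_matrix_mult: "(c *\<^sub>R x) v* M = c *\<^sub>R (x v* M)"
  for x :: "real^'m" and M :: "real^'n^'m"
  by (simp add: vec_eq_iff vector_matrix_mult_def sum_distrib_left mult_ac)

lemma weight_condition_scaleR:
  assumes "weight_condition A b r" and "0 \<le> t" and "t \<le> 1"
  shows "weight_condition A (t *\<^sub>R b) r"
proof -
  have nonneg: "0 \<le> b v* resolvent r A"
    and bound: "r * ((b v* resolvent r A) \<bullet> 1) \<le> 1"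
    using assms(1) by (auto simp: weight_condition_def)
  have "0 \<le> (t *\<^sub>R b) v* resolvent r A"
    using nonneg \<open>0 \<le> t\<close> by (simp add: vector_scaleR_matrix_mult less_eq_vec_def)
  moreover have "r * (((t *\<^sub>R b) v* resolvent r A) \<bullet> 1) = t * (r * ((b v* resolvent r A) \<bullet> 1))"
    by (simp add: vector_scaleR_matrix_mult)
  \<comment> \<open>Scaling the bound by t \<ge> 0 gives at most t, hence at most 1; the sign of the
    left side does not matter.\<close>
  moreover have "t * (r * ((b v* resolvent r A) \<bullet> 1)) \<le> 1"
    using mult_left_mono[OF bound \<open>0 \<le> t\<close>] \<open>t \<le> 1\<close> by linarith
  ultimately show ?thesis
    unfolding weight_condition_def by metis
qed

text \<open>The endpoint \<theta> = 1 recovers the condition on \<open>b\<close>; the converse is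
  the scaling lemma.\<close>

lemma all_weight_condition_scaleR_iff:
  "(\<forall>\<theta>\<in>{0..1}. weight_condition A (\<theta> *\<^sub>R b) r) \<longleftrightarrow> weight_condition A b r"
proof
  assume "\<forall>\<theta>\<in>{0..1}. weight_condition A (\<theta> *\<^sub>R b) r"
  then have "weight_condition A (1 *\<^sub>R b) r"
    by (rule bspec) simp
  then show "weight_condition A b r"
    by simp
qed (simp add: weight_condition_scaleR)

theorem theorem4:
  fixes A :: "real^'s^'s" and b :: "real^'s" and bb :: "real \<Rightarrow> real^'s"
  assumes order: "rk_order_at_least_one b"
    and ssp_pos: "ssp_coeff A b > 0"
    and bb: "\<And>\<theta> j. \<theta> \<in> {0..1} \<Longrightarrow> bb \<theta> $ j = b $ j * \<theta>"
  shows "first_order_dense bb \<and>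
         ssp_coeff_dense A bb = ssp_coeff A b \<and>
         (\<forall>(f :: 'v::real_vector \<Rightarrow> 'v) h u y. \<forall>\<theta>\<in>{0..1}. rk_stages A f h u y \<longrightarrow>
            dense_output bb f h u y \<theta> = u + (h * \<theta>) *\<^sub>R (\<Sum>j\<in>UNIV. (b $ j) *\<^sub>R f (y j)))"
proof -
  \<comment> \<open>Nothing is known about \<open>bb\<close> outside [0,1], so this identity of
    vectors stays conditional.\<close>
  have bb_scaleR: "bb \<theta> = \<theta> *\<^sub>R b" if "\<theta> \<in> {0..1}" for \<theta>
    using bb[OF that] by (simp add: vec_eq_iff mult.commute)
  have "first_order_dense bb"
    using order
    by (simp add: first_order_dense_def rk_order_at_least_one_def bb_scaleR flip: sum_distrib_left)
  \<comment> \<open>The equivalence holds for each \<open>r\<close>, so the two sets of admissible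
    \<open>r\<close> are equal and no limit argument is needed for their suprema.\<close>
  moreover have "(\<forall>\<theta>\<in>{0..1}. weight_condition A (bb \<theta>) r) \<longleftrightarrow> weight_condition A b r" for r
    using all_weight_condition_scaleR_iff[of A b r] bb_scaleR by metis
  then have "ssp_coeff_dense A bb = ssp_coeff A b"
    by (simp only: ssp_coeff_dense_def ssp_coeff_def)
  moreover have "dense_output bb f h u y \<theta> = u + (h * \<theta>) *\<^sub>R (\<Sum>j\<in>UNIV. (b $ j) *\<^sub>R f (y j))"
    if "\<theta> \<in> {0..1}" for f :: "'v \<Rightarrow> 'v" and h u y \<theta>
    using that by (simp add: dense_output_def bb_scaleR scaleR_sum_right mult.assoc)
  ultimately show ?thesis
    by blast
qed

end
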